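(* Let $g,q,z_d\in\mathbb{R}$ and $M_3>0$. Let $u_{b_{op}}$ be the solution of $(S)$ for $b=b_{op}$, the minimizer of $J_3$ over $\mathbb{R}$, and for $h=x_0/n$ let $u^h_{b^h_{op}}$ be the discrete solution for $b=b^h_{op}$, the minimizer of $J_3^h$ over $\mathbb{R}$. Then there are constants $C_{15},C_{16}$ that do not depend on $h$ such that, as $h\to0$ ($h=x_0/n$, $n\to\infty$), $$\text{(a)}\quad\|u^h_{b^h_{op}}-u_{b_{op}}\|_H=C_{15}h+o(h),\qquad\text{(b)}\quad\left\|\frac{\partial u^h_{b^h_{op}}}{\partial x}-\frac{\partial u_{b_{op}}}{\partial x}\right\|_H=C_{16}h+o(h).$$
   Context: Fix $x_0,y_0>0$, $\Omega=(0,x_0)\times(0,y_0)$, $\Gamma_1=\{0\}\times(0,y_0]$, $H=L^2(\Omega)$ with its standard norm, $B=H^{1/2}(\Gamma_1)$. For constants $g,q,b\in\mathbb{R}$, system $(S)$: $-\Delta u=g$ in $\Omega$, $u=b$ on $\Gamma_1$, $-\partial u/\partial n=q$ on $\{x_0\}\times(0,y_0]$, $-\partial u/\partial n=0$ on $[0,x_0]\times\{0,y_0\}$, has solution $u_b(x,y)=-\tfrac12gx^2+(gx_0-q)x+b$. For an integer $n\ge1$, $h=x_0/n$, $x_i=(i-1)h$, its discrete (finite-difference, piecewise linear) approximation is $u^h_b(x,y)=(gx_0-q-hgi)x+h^2g\tfrac{i(i-1)}2+b$ for $x\in[x_i,x_{i+1}]$, $y\in[0,y_0]$, $i=1,\dots,n$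 (its $x$-derivative is piecewise constant, defined a.e.). For fixed $g,q,z_d\in\mathbb{R}$ and $M_3>0$ the cost functions on $\mathbb{R}$ are $J_3(b)=\tfrac12\|u_b-z_d\|_H^2+\tfrac{M_3}2\|b\|_B^2$ and $J^h_3(b)=\tfrac12\|u^h_b-z_d\|_H^2+\tfrac{M_3}2\|b\|_B^2$, where $\|b\|_B^2=y_0b^2$ for constant $b$. The minimizers are $b_{op}=\left(-\tfrac{gx_0^2}3+\tfrac{qx_0}2+z_d\right)\Big/\left(1+\tfrac{M_3}{x_0}\right)$ and $b^h_{op}=b_{op}+E_1gx_0h\left(1+\tfrac h{3x_0}\right)$ with $E_1=\tfrac14\left(1+\tfrac{M_3}{x_0}\right)^{-1}$. *)

theory Defs
  imports "HOL-Analysis.Analysis" "HOL-Library.Landau_Symbols"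
begin

definition rect :: "real \<Rightarrow> real \<Rightarrow> (real \<times> real) set"
  where "rect x0 y0 = {0<..<x0} \<times> {0<..<y0}"

definition L2_norm_on :: "(real \<times> real) set \<Rightarrow> (real \<times> real \<Rightarrow> real) \<Rightarrow> real"
  where "L2_norm_on S f = sqrt (LINT p:S|lebesgue. (f p)\<^sup>2)"

definition partial_x :: "(real \<times> real \<Rightarrow> real) \<Rightarrow> real \<times> real \<Rightarrow> real"
  where "partial_x u p = deriv (\<lambda>s. u (s, snd p)) (fst p)"

definition partial_y :: "(real \<times> real \<Rightarrow> real) \<Rightarrow> real \<times> real \<Rightarrow> real"
  where "partial_y u p = deriv (\<lambda>s. u (fst p, s)) (snd p)"

definition laplacian :: "(real \<times> real \<Rightarrow> real) \<Rightarrow> real \<times> real \<Rightarrow> real"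
  where "laplacian u p = partial_x (partial_x u) p + partial_y (partial_y u) p"

definition C1_on :: "(real \<times> real) set \<Rightarrow> (real \<times> real \<Rightarrow> real) \<Rightarrow> bool"
  where "C1_on S u \<longleftrightarrow>
    u differentiable_on S \<and> continuous_on S (partial_x u) \<and> continuous_on S (partial_y u)"

definition C2_on :: "(real \<times> real) set \<Rightarrow> (real \<times> real \<Rightarrow> real) \<Rightarrow> bool"
  where "C2_on S u \<longleftrightarrow> C1_on S u \<and> C1_on S (partial_x u) \<and> C1_on S (partial_y u)"

text \<open>\<open>has_normal_deriv u p \<nu> d\<close>: the derivative of \<open>u\<close> at the boundary point \<open>p\<close> in the
  direction of the outward normal \<open>\<nu>\<close> is \<open>d\<close>.  It is one-sided, since \<open>p + t *\<^sub>R \<nu>\<close> lies in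
  the closed domain only for \<open>t \<le> 0\<close>.\<close>

definition has_normal_deriv ::
    "(real \<times> real \<Rightarrow> real) \<Rightarrow> real \<times> real \<Rightarrow> real \<times> real \<Rightarrow> real \<Rightarrow> bool"
  where "has_normal_deriv u p \<nu> d \<longleftrightarrow>
    ((\<lambda>t. u (p + t *\<^sub>R \<nu>)) has_real_derivative d) (at_left 0)"

text \<open>Classical solutions, in \<open>C\<^sup>2(\<Omega>) \<inter> C(closure \<Omega>)\<close>, of the mixed problem with source \<open>g\<close>,
  flux \<open>q\<close> through the right edge, and value \<open>b\<close> on the left edge.  The function is
  unconstrained outside the closed rectangle.\<close>

definition solves_S ::
    "real \<Rightarrow> real \<Rightarrow> real \<Rightarrow> real \<Rightarrow> real \<Rightarrow> (real \<times> real \<Rightarrow> real) \<Rightarrow> bool"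
  where "solves_S x0 y0 g q b u \<longleftrightarrow>
    continuous_on ({0..x0} \<times> {0..y0}) u \<and>
    C2_on (rect x0 y0) u \<and>
    (\<forall>p \<in> rect x0 y0. - laplacian u p = g) \<and>
    (\<forall>y \<in> {0<..y0}. u (0, y) = b) \<and>
    (\<forall>y \<in> {0<..y0}. has_normal_deriv u (x0, y) (1, 0) (- q)) \<and>
    (\<forall>x \<in> {0..x0}. has_normal_deriv u (x, 0) (0, -1) 0) \<and>
    (\<forall>x \<in> {0..x0}. has_normal_deriv u (x, y0) (0, 1) 0)"

lemma solves_S_explicit:
  "solves_S x0 y0 g q b (\<lambda>(x, y). - (1/2) * g * x\<^sup>2 + (g * x0 - q) * x + b)"
proof -
  define u :: "real \<times> real \<Rightarrow> real"
    where "u = (\<lambda>p. - (1/2) * g * (fst p)\<^sup>2 + (g * x0 - q) * fst p + b)"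
  have px: "partial_x u = (\<lambda>p. - g * fst p + (g * x0 - q))"
    by (rule ext) (auto simp: partial_x_def u_def intro!: DERIV_imp_deriv derivative_eq_intros)
  have py: "partial_y u = (\<lambda>p. 0)"
    by (rule ext) (simp add: partial_y_def u_def)
  have pxx: "partial_x (partial_x u) = (\<lambda>p. - g)"
    unfolding px
    by (rule ext) (auto simp: partial_x_def intro!: DERIV_imp_deriv derivative_eq_intros)
  have pyx: "partial_y (partial_x u) = (\<lambda>p. 0)"
    unfolding px by (rule ext) (simp add: partial_y_def)
  have p0: "partial_x (\<lambda>p. 0) = (\<lambda>p. 0)" "partial_y (\<lambda>p. 0) = (\<lambda>p. 0)"
    by (auto simp: partial_x_def partial_y_def)
  have du: "u differentiable_on S" for S
  proof (rule differentiable_at_imp_differentiable_on)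
    fix p
    have "(u has_derivative (\<lambda>d. (- g * fst p + (g * x0 - q)) * fst d)) (at p)"
      unfolding u_def by (auto intro!: derivative_eq_intros simp: algebra_simps)
    then show "u differentiable at p" by (rule differentiableI)
  qed
  have dux: "partial_x u differentiable_on S" for S
  proof (rule differentiable_at_imp_differentiable_on)
    fix p
    have "(partial_x u has_derivative (\<lambda>d. - g * fst d)) (at p)"
      unfolding px by (auto intro!: derivative_eq_intros)
    then show "partial_x u differentiable at p" by (rule differentiableI)
  qed
  have "C2_on S u" for S
    unfolding C2_on_def C1_on_def pxx pyx
    using du dux by (auto simp: px py p0 intro!: continuous_intros)
  moreover have "- laplacian u p = g" for p
    by (simp add: laplacian_def pxx py p0)
  moreover have "continuous_on S u" for S
    unfolding u_def by (intro continuous_intros)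
  moreover have "has_normal_deriv u (x0, y) (1, 0) (- q)" for y
    by (auto simp: has_normal_deriv_def u_def intro!: derivative_eq_intros)
  moreover have "has_normal_deriv u (x, 0) (0, -1) 0" "has_normal_deriv u (x, y0) (0, 1) 0" for x
    by (auto simp: has_normal_deriv_def u_def intro!: derivative_eq_intros)
  ultimately have "solves_S x0 y0 g q b u"
    unfolding solves_S_def by (simp add: u_def)
  then show ?thesis
    by (simp add: u_def case_prod_unfold)
qed

text \<open>The cell index \<open>i\<close> is read off from \<open>x\<close>.  At a node the formulas of the two adjacent cells
  agree, so the half-open choice made by the floor function is immaterial.\<close>

definition u_disc :: "real \<Rightarrow> real \<Rightarrow> real \<Rightarrow> nat \<Rightarrow> real \<Rightarrow> real \<times> real \<Rightarrow> real"
  where "u_disc x0 g q n b p =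
    (let h = x0 / real n; i = real_of_int (\<lfloor>fst p / h\<rfloor> + 1)
     in (g * x0 - q - h * g * i) * fst p + h\<^sup>2 * g * (i * (i - 1) / 2) + b)"

lemma u_disc_cell:
  assumes "x0 > 0" "i \<in> {1..n}" and h: "h = x0 / real n"
    and x: "x \<in> {(real i - 1) * h .. real i * h}"
  shows "u_disc x0 g q n b (x, y) =
    (g * x0 - q - h * g * real i) * x + h\<^sup>2 * g * (real i * (real i - 1) / 2) + b"
proof -
  have hpos: "h > 0" using assms by auto
  show ?thesis
  proof (cases "x = real i * h")
    case True
    then have "\<lfloor>x / h\<rfloor> = int i" using hpos by simp
    then show ?thesis using True unfolding u_disc_def h[symmetric] Let_def
      by (simp add: field_simps power2_eq_square)
  next
    case False
    then have "real i - 1 \<le> x / h" "x / h < real i"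
      using x hpos by (auto simp: field_simps)
    then have "\<lfloor>x / h\<rfloor> = int i - 1" by (simp add: floor_eq_iff)
    then show ?thesis unfolding u_disc_def h[symmetric] Let_def by simp
  qed
qed

text \<open>\<open>u\<close> is the control-to-state map, so that both the continuous and the discrete functional are
  instances.  The control is a constant \<open>b\<close>, whose squared norm in \<open>H\<^sup>1\<^sup>/\<^sup>2\<close> of the left edge is
  \<open>y0 * b\<^sup>2\<close>.\<close>

definition cost ::
    "real \<Rightarrow> real \<Rightarrow> real \<Rightarrow> real \<Rightarrow> (real \<Rightarrow> real \<times> real \<Rightarrow> real) \<Rightarrow> real \<Rightarrow> real"
  where "cost x0 y0 z\<^sub>d M u b =
    1/2 * (L2_norm_on (rect x0 y0) (\<lambda>p. u b p - z\<^sub>d))\<^sup>2 + M/2 * (y0 * b\<^sup>2)"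

end

theory Submission
  imports Defs
begin

text \<open>Both states are explicit.  A maximum principle (\<open>solution_le_solution\<close>) shows that the
  classical solution of the mixed problem is unique, so on the rectangle the exact state is \<open>v x + b\<close> with
  \<open>v x = - g x\<^sup>2 / 2 + (g x\<^sub>0 - q) x\<close>.  The discrete state with the same control differs from it by
  \<open>- (g / 2) h x - (g / 2) t (h - t)\<close>, where \<open>t\<close> is the distance of \<open>x\<close> from the left node of its cell
  (\<open>disc_minus_exact\<close>).

  (a) The state error at a fixed control, divided by \<open>h\<close>, therefore converges boundedly to
  \<open>- (g / 2) x\<close>.  The control enters additively, so both costs are quadratics in \<open>b\<close> whose
  minimizer is an affine function of the integral of the state at control \<open>0\<close>
  (\<open>minimizer_of_cost\<close>).  Consequently the error of the optimal control, divided by \<open>h\<close>, converges to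
  a constant \<open>\<kappa>\<close>.  The total error divided by \<open>h\<close> converges boundedly to \<open>- (g / 2) x + \<kappa>\<close>, and by
  dominated convergence its norm converges to the norm of that function, which is the first
  constant.

  (b) The control disappears from the derivatives.  On a cell the derivative error is
  \<open>- g (h - t)\<close>, so the square of its norm is exactly \<open>g\<^sup>2 h\<^sup>2 x\<^sub>0 y\<^sub>0 / 3\<close>
  (\<open>L2_norm_partial_x_disc_minus_exact\<close>); the second constant is \<open>\<bar>g\<bar> sqrt (x\<^sub>0 y\<^sub>0 / 3)\<close>, without
  remainder.\<close>

section \<open>Uniqueness for the mixed boundary value problem\<close>

lemma deriv2_nonpos_at_interior_max:
  fixes f f' :: "real \<Rightarrow> real"
  assumes ab: "c \<in> {a<..<b}"
    and f: "\<And>s. s \<in> {a<..<b} \<Longrightarrow> (f has_real_derivative f' s) (at s)"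
    and f': "(f' has_real_derivative d) (at c)"
    and max: "\<And>s. s \<in> {a<..<b} \<Longrightarrow> f s \<le> f c"
  shows "d \<le> 0"
proof (rule ccontr)
  assume "\<not> d \<le> 0"
  then have "d > 0" by simp
  define r where "r = min (c - a) (b - c)"
  have "f' c = 0"
  proof (rule DERIV_local_max[OF f[OF ab]])
    show "0 < r" using ab by (simp add: r_def)
    show "\<forall>y. \<bar>c - y\<bar> < r \<longrightarrow> f y \<le> f c"
      using max by (auto simp: r_def abs_less_iff)
  qed
  from DERIV_pos_inc_right[OF f' \<open>d > 0\<close>] obtain e where "e > 0"
    and e: "\<And>k. 0 < k \<Longrightarrow> k < e \<Longrightarrow> f' c < f' (c + k)" by auto
  define k where "k = min (e / 2) ((b - c) / 2)"
  have k: "0 < k" "k < e" "c + k < b" using ab \<open>e > 0\<close> by (auto simp: k_def min_def field_simps)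
  have "f c < f (c + k)"
  proof (rule DERIV_pos_imp_increasing_open[of c "c + k" f])
    show "c < c + k" using k by simp
    show "\<exists>y. (f has_real_derivative y) (at x) \<and> 0 < y" if "c < x" "x < c + k" for x
      using f[of x] e[of "x - c"] that k ab \<open>f' c = 0\<close> by auto
    show "continuous_on {c..c + k} f"
    proof (rule continuous_at_imp_continuous_on, rule ballI)
      fix x assume "x \<in> {c..c + k}"
      then have "x \<in> {a<..<b}" using k ab by auto
      from DERIV_isCont[OF f[OF this]] show "isCont f x" .
    qed
  qed
  with max[of "c + k"] k ab show False by auto
qed

text \<open>Only points strictly inside along the normal are compared with \<open>p\<close>, so the lemma applies at
  corners as well as on open edges.\<close>

lemma normal_deriv_nonneg_at_max:
  assumes "has_normal_deriv w p \<nu> d" and "\<delta> > 0"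
    and "\<And>t. - \<delta> < t \<Longrightarrow> t < 0 \<Longrightarrow> w (p + t *\<^sub>R \<nu>) \<le> w p"
  shows "d \<ge> 0"
proof (rule ccontr)
  assume "\<not> d \<ge> 0"
  then obtain e where "e > 0"
    and e: "\<And>k. 0 < k \<Longrightarrow> k < e \<Longrightarrow> w p < w (p + (- k) *\<^sub>R \<nu>)"
    using has_real_derivative_neg_dec_left[OF assms(1)[unfolded has_normal_deriv_def]] by auto
  define k where "k = min (e / 2) (\<delta> / 2)"
  have "0 < k" "k < e" "k < \<delta>" using \<open>e > 0\<close> \<open>\<delta> > 0\<close> by (auto simp: k_def min_def)
  with e[of k] assms(3)[of "- k"] show False by auto
qed

lemma C1_on_partial_derivatives:
  assumes "C1_on S u" "open S" "p \<in> S"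
  shows "((\<lambda>s. u (s, snd p)) has_real_derivative partial_x u p) (at (fst p))"
    and "((\<lambda>s. u (fst p, s)) has_real_derivative partial_y u p) (at (snd p))"
proof -
  from assms have "u differentiable at (fst p, snd p)"
    by (simp add: C1_on_def differentiable_on_eq_differentiable_at)
  moreover have "(\<lambda>s. (s, snd p)) differentiable at (fst p)"
    "(\<lambda>s. (fst p, s)) differentiable at (snd p)"
    by (auto intro!: differentiableI derivative_intros)
  ultimately have "(u \<circ> (\<lambda>s. (s, snd p))) differentiable at (fst p)"
    "(u \<circ> (\<lambda>s. (fst p, s))) differentiable at (snd p)"
    by (auto intro!: differentiable_chain_at)
  then show "((\<lambda>s. u (s, snd p)) has_real_derivative partial_x u p) (at (fst p))"
    and "((\<lambda>s. u (fst p, s)) has_real_derivative partial_y u p) (at (snd p))"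
    unfolding partial_x_def partial_y_def o_def DERIV_deriv_iff_real_differentiable by this+
qed

lemma C2_on_partial_derivatives:
  assumes "C2_on S u" "open S" "p \<in> S"
  shows "((\<lambda>s. u (s, snd p)) has_real_derivative partial_x u p) (at (fst p))"
    and "((\<lambda>s. u (fst p, s)) has_real_derivative partial_y u p) (at (snd p))"
    and "((\<lambda>s. partial_x u (s, snd p)) has_real_derivative partial_x (partial_x u) p) (at (fst p))"
    and "((\<lambda>s. partial_y u (fst p, s)) has_real_derivative partial_y (partial_y u) p) (at (snd p))"
  using assms C1_on_partial_derivatives unfolding C2_on_def by blast+

lemma open_rect: "open (rect x0 y0)"
  by (simp add: rect_def open_Times)

text \<open>A comparison principle for the mixed problem, from which uniqueness follows by symmetry.
  The function \<open>\<psi>\<close> has positive Laplacian and strictly negative outward derivative on the bottom,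
  top and right edges, corners included.  For \<open>\<epsilon> > 0\<close> the perturbed difference \<open>u - v + \<epsilon> \<psi>\<close> is then
  strictly subharmonic, which excludes an interior maximum, and it increases towards the interior
  at every Neumann point, which excludes a maximum there.  Its maximum lies on the left edge, where
  \<open>u = v\<close>, and \<open>\<epsilon>\<close> tends to \<open>0\<close>.  The strict sign of the derivative of \<open>\<psi>\<close> takes the place of Hopf's
  boundary lemma, whose interior ball condition fails at the corners.\<close>

lemma solution_le_solution:
  assumes pos: "x0 > 0" "y0 > 0"
    and u: "solves_S x0 y0 g q b u" and v: "solves_S x0 y0 g q b v"
    and p: "p \<in> {0..x0} \<times> {0..y0}"
  shows "u p \<le> v p"
proof -
  define K where "K = {0..x0} \<times> {0..y0}"
  define \<psi> :: "real \<times> real \<Rightarrow> real"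
    where "\<psi> = (\<lambda>p. 2 * (fst p - 2 * x0)\<^sup>2 - (snd p - y0 / 2)\<^sup>2)"
  have bound: "u p - v p \<le> \<epsilon> * (8 * x0\<^sup>2 - \<psi> p)" if "\<epsilon> > 0" for \<epsilon>
  proof -
    define w where "w = (\<lambda>p. u p - v p + \<epsilon> * \<psi> p)"
    have "continuous_on K w"
      using u v unfolding w_def \<psi>_def solves_S_def K_def by (intro continuous_intros) auto
    moreover have "compact K" "K \<noteq> {}" using pos by (auto simp: K_def compact_Times)
    ultimately obtain m where "m \<in> K" and m: "\<And>r. r \<in> K \<Longrightarrow> w r \<le> w m"
      by (metis continuous_attains_sup)
    obtain x y where xy: "m = (x, y)" by fastforce
    have K: "0 \<le> x" "x \<le> x0" "0 \<le> y" "y \<le> y0" using \<open>m \<in> K\<close> by (auto simp: xy K_def)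
    \<comment> \<open>If the outward derivative of \<open>\<psi>\<close> at \<open>m\<close> is negative and those of \<open>u\<close> and \<open>v\<close> agree, \<open>w\<close>
      increases from \<open>m\<close> into the rectangle, against the choice of \<open>m\<close>.\<close>
    have not_on_edge: False
      if "has_normal_deriv u m \<nu> d" "has_normal_deriv v m \<nu> d" "has_normal_deriv \<psi> m \<nu> e"
        and "e < 0" "\<delta> > 0" "\<And>t. - \<delta> < t \<Longrightarrow> t < 0 \<Longrightarrow> m + t *\<^sub>R \<nu> \<in> K" for \<nu> d e \<delta>
    proof -
      have "has_normal_deriv w m \<nu> (d - d + \<epsilon> * e)"
        using that(1-3) unfolding has_normal_deriv_def w_def
        by (intro DERIV_add DERIV_diff DERIV_cmult)
      then have "0 \<le> d - d + \<epsilon> * e"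
        by (rule normal_deriv_nonneg_at_max[OF _ \<open>\<delta> > 0\<close>]) (intro m that(6))
      then show False using \<open>\<epsilon> > 0\<close> \<open>e < 0\<close> by (simp add: zero_le_mult_iff)
    qed
    have not_bottom: "y \<noteq> 0"
    proof
      assume "y = 0"
      have "has_normal_deriv \<psi> m (0, -1) (- y0)"
        unfolding has_normal_deriv_def \<psi>_def xy \<open>y = 0\<close>
        by (auto intro!: derivative_eq_intros)
      moreover have "has_normal_deriv u m (0, -1) 0" "has_normal_deriv v m (0, -1) 0"
        using u v K \<open>y = 0\<close> unfolding solves_S_def xy by simp_all
      ultimately show False
        using not_on_edge[of "(0, -1)" 0 "- y0" y0] pos K \<open>y = 0\<close> by (simp add: xy K_def)
    qed
    have not_top: "y \<noteq> y0"
    proof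
      assume "y = y0"
      have "has_normal_deriv \<psi> m (0, 1) (- y0)"
        unfolding has_normal_deriv_def \<psi>_def xy \<open>y = y0\<close>
        by (auto intro!: derivative_eq_intros)
      moreover have "has_normal_deriv u m (0, 1) 0" "has_normal_deriv v m (0, 1) 0"
        using u v K \<open>y = y0\<close> unfolding solves_S_def xy by simp_all
      ultimately show False
        using not_on_edge[of "(0, 1)" 0 "- y0" y0] pos K \<open>y = y0\<close> by (simp add: xy K_def)
    qed
    have not_right: "x \<noteq> x0"
    proof
      assume "x = x0"
      have "has_normal_deriv \<psi> m (1, 0) (- 4 * x0)"
        unfolding has_normal_deriv_def \<psi>_def xy \<open>x = x0\<close>
        by (auto intro!: derivative_eq_intros)
      moreover have "has_normal_deriv u m (1, 0) (- q)" "has_normal_deriv v m (1, 0) (- q)"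
        using u v K not_bottom \<open>x = x0\<close> unfolding solves_S_def xy by simp_all
      ultimately show False
        using not_on_edge[of "(1, 0)" "- q" "- 4 * x0" x0] pos K \<open>x = x0\<close> by (simp add: xy K_def)
    qed
    have "x = 0"
    proof (rule ccontr)
      assume "x \<noteq> 0"
      then have int: "x \<in> {0<..<x0}" "y \<in> {0<..<y0}" and R: "(x, y) \<in> rect x0 y0"
        using K not_bottom not_top not_right by (auto simp: rect_def)
      have C2: "C2_on (rect x0 y0) u" "C2_on (rect x0 y0) v"
        using u v unfolding solves_S_def by blast+
      note Du = C2_on_partial_derivatives[OF C2(1) open_rect]
      note Dv = C2_on_partial_derivatives[OF C2(2) open_rect]
      have "partial_x (partial_x u) (x, y) - partial_x (partial_x v) (x, y) + \<epsilon> * 4 \<le> 0"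
      proof (rule deriv2_nonpos_at_interior_max[OF int(1)])
        show "((\<lambda>s. w (s, y)) has_real_derivative
            partial_x u (s, y) - partial_x v (s, y) + \<epsilon> * (4 * (s - 2 * x0))) (at s)"
          if "s \<in> {0<..<x0}" for s
          using Du(1)[of "(s, y)"] Dv(1)[of "(s, y)"] that int unfolding w_def \<psi>_def
          by (auto simp: rect_def algebra_simps intro!: derivative_eq_intros)
        show "((\<lambda>s. partial_x u (s, y) - partial_x v (s, y) + \<epsilon> * (4 * (s - 2 * x0)))
            has_real_derivative
              partial_x (partial_x u) (x, y) - partial_x (partial_x v) (x, y) + \<epsilon> * 4) (at x)"
          using Du(3)[of "(x, y)"] Dv(3)[of "(x, y)"] R
          by (auto intro!: derivative_eq_intros)
        show "w (s, y) \<le> w (x, y)" if "s \<in> {0<..<x0}" for s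
          using m[of "(s, y)"] that K by (auto simp: xy K_def)
      qed
      moreover have
        "partial_y (partial_y u) (x, y) - partial_y (partial_y v) (x, y) - \<epsilon> * 2 \<le> 0"
      proof (rule deriv2_nonpos_at_interior_max[OF int(2)])
        show "((\<lambda>s. w (x, s)) has_real_derivative
            partial_y u (x, s) - partial_y v (x, s) - \<epsilon> * (2 * (s - y0 / 2))) (at s)"
          if "s \<in> {0<..<y0}" for s
          using Du(2)[of "(x, s)"] Dv(2)[of "(x, s)"] that int unfolding w_def \<psi>_def
          by (auto simp: rect_def algebra_simps intro!: derivative_eq_intros)
        show "((\<lambda>s. partial_y u (x, s) - partial_y v (x, s) - \<epsilon> * (2 * (s - y0 / 2)))
            has_real_derivative
              partial_y (partial_y u) (x, y) - partial_y (partial_y v) (x, y) - \<epsilon> * 2) (at y)"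
          using Du(4)[of "(x, y)"] Dv(4)[of "(x, y)"] R
          by (auto intro!: derivative_eq_intros)
        show "w (x, s) \<le> w (x, y)" if "s \<in> {0<..<y0}" for s
          using m[of "(x, s)"] that K by (auto simp: xy K_def)
      qed
      \<comment> \<open>The Laplacian of \<open>w\<close> at \<open>m\<close> would be at most \<open>0\<close>, but it is \<open>2 \<epsilon>\<close>.\<close>
      moreover have "laplacian u (x, y) = laplacian v (x, y)"
        using u v R unfolding solves_S_def by (metis minus_equation_iff)
      ultimately show False using \<open>\<epsilon> > 0\<close> by (simp add: laplacian_def)
    qed
    have "w m = \<epsilon> * \<psi> m"
      using u v K not_bottom \<open>x = 0\<close> unfolding solves_S_def w_def xy by simp
    also have "\<psi> m \<le> 8 * x0\<^sup>2"
      using \<open>x = 0\<close> by (simp add: \<psi>_def xy power2_eq_square)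
    finally have "w p \<le> \<epsilon> * (8 * x0\<^sup>2)"
      using m[of p] p \<open>\<epsilon> > 0\<close> by (simp add: K_def mem_Times_iff)
    then show ?thesis by (simp add: w_def algebra_simps)
  qed
  have "((\<lambda>\<epsilon>. \<epsilon> * (8 * x0\<^sup>2 - \<psi> p)) \<longlongrightarrow> 0 * (8 * x0\<^sup>2 - \<psi> p)) (at_right 0)"
    by (intro tendsto_intros)
  then have "u p - v p \<le> 0 * (8 * x0\<^sup>2 - \<psi> p)"
    by (rule tendsto_lowerbound)
       (use bound in \<open>auto intro: eventually_mono[OF eventually_at_right_less]\<close>)
  then show ?thesis by simp
qed

lemma solution_unique:
  assumes "x0 > 0" "y0 > 0" "solves_S x0 y0 g q b u" "p \<in> {0..x0} \<times> {0..y0}"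
  shows "u p = - (1/2) * g * (fst p)\<^sup>2 + (g * x0 - q) * fst p + b"
  using solution_le_solution[OF assms(1,2) assms(3) solves_S_explicit assms(4)]
    solution_le_solution[OF assms(1,2) solves_S_explicit assms(3) assms(4)]
  by (simp add: case_prod_unfold)

section \<open>The \<open>L\<^sup>2\<close> norm on the rectangle\<close>

lemma measure_rect:
  assumes "x0 > 0" "y0 > 0"
  shows "rect x0 y0 \<in> lmeasurable" and "measure lebesgue (rect x0 y0) = x0 * y0"
proof -
  have eq: "rect x0 y0 = box (0, 0) (x0, y0)"
    by (force simp: rect_def box_def Basis_prod_def)
  show "rect x0 y0 \<in> lmeasurable" by (simp add: eq)
  show "measure lebesgue (rect x0 y0) = x0 * y0"
    using assms content_Pair[of "0::real" "0::real" x0 y0]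
    by (simp add: eq measure_lborel_box_eq measure_lborel_cbox_eq)
qed

lemma L2_norm_on_cong:
  assumes "\<And>p. p \<in> S \<Longrightarrow> f p = g p"
  shows "L2_norm_on S f = L2_norm_on S g"
  unfolding L2_norm_on_def set_lebesgue_integral_def
  by (intro arg_cong[where f = sqrt] Bochner_Integration.integral_cong)
     (auto simp: assms indicator_def)

lemma L2_norm_on_scale: "L2_norm_on S (\<lambda>p. c * f p) = \<bar>c\<bar> * L2_norm_on S f"
  by (simp add: L2_norm_on_def power_mult_distrib real_sqrt_mult)

lemma L2_norm_on_power2: "(L2_norm_on S f)\<^sup>2 = (LINT p:S|lebesgue. (f p)\<^sup>2)"
  unfolding L2_norm_on_def set_lebesgue_integral_def
  by (intro real_sqrt_pow2 Bochner_Integration.integral_nonneg) (auto simp: indicator_def)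

lemma set_integrable_bounded:
  fixes f :: "'a::euclidean_space \<Rightarrow> real"
  assumes "S \<in> lmeasurable" "f \<in> borel_measurable lebesgue" "\<And>p. p \<in> S \<Longrightarrow> \<bar>f p\<bar> \<le> K"
  shows "set_integrable lebesgue S f"
  unfolding set_integrable_def using assms
  by (intro integrableI_bounded_set_indicator[where B = K]) (auto simp: fmeasurable_def)

lemma set_integral_bounded_convergence:
  fixes f :: "nat \<Rightarrow> 'a::euclidean_space \<Rightarrow> real"
  assumes S: "S \<in> lmeasurable"
    and f: "\<And>n. f n \<in> borel_measurable lebesgue" and g: "g \<in> borel_measurable lebesgue"
    and bound: "\<And>n p. p \<in> S \<Longrightarrow> \<bar>f n p\<bar> \<le> K"
    and lim: "\<And>p. p \<in> S \<Longrightarrow> (\<lambda>n. f n p) \<longlonglongrightarrow> g p"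
  shows "(\<lambda>n. LINT p:S|lebesgue. f n p) \<longlonglongrightarrow> (LINT p:S|lebesgue. g p)"
  unfolding set_lebesgue_integral_def
proof (rule integral_dominated_convergence[where w = "\<lambda>p. indicator S p *\<^sub>R K"])
  have [measurable]: "S \<in> sets lebesgue" using S by auto
  note f[measurable] g[measurable]
  show "(\<lambda>p. indicat_real S p *\<^sub>R g p) \<in> borel_measurable lebesgue" by measurable
  show "(\<lambda>p. indicat_real S p *\<^sub>R f n p) \<in> borel_measurable lebesgue" for n by measurable
  show "integrable lebesgue (\<lambda>p. indicat_real S p *\<^sub>R K)"
    using set_integrable_bounded[OF S, of "\<lambda>_. K" "\<bar>K\<bar>"] by (simp add: set_integrable_def)
qed (use bound lim in \<open>auto simp: indicator_def\<close>)

lemma L2_norm_on_bounded_convergence: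
  assumes S: "S \<in> lmeasurable"
    and f: "\<And>n. f n \<in> borel_measurable lebesgue" and g: "g \<in> borel_measurable lebesgue"
    and bound: "\<And>n p. p \<in> S \<Longrightarrow> \<bar>f n p\<bar> \<le> K"
    and lim: "\<And>p. p \<in> S \<Longrightarrow> (\<lambda>n. f n p) \<longlonglongrightarrow> g p"
  shows "(\<lambda>n. L2_norm_on S (f n)) \<longlonglongrightarrow> L2_norm_on S g"
  unfolding L2_norm_on_def
proof (intro tendsto_real_sqrt set_integral_bounded_convergence[OF S, where K = "K\<^sup>2"])
  show "\<bar>(f n p)\<^sup>2\<bar> \<le> K\<^sup>2" if "p \<in> S" for n p
    using power_mono[OF bound[OF that] abs_ge_zero, of n 2] by simp
qed (use f g lim in \<open>auto intro!: tendsto_intros borel_measurable_power\<close>)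

text \<open>Tonelli's theorem, for functions of the first coordinate only.  The passage to a
  Henstock-Kurzweil integral over \<open>[0, x\<^sub>0]\<close> makes it possible to integrate cell by cell and to
  ignore the nodes, where the discrete derivative is unspecified.\<close>

lemma L2_norm_on_rect_fst:
  fixes f :: "real \<Rightarrow> real"
  assumes pos: "x0 > 0" "y0 > 0" and f [measurable]: "f \<in> borel_measurable borel"
    and I: "((\<lambda>s. (f s)\<^sup>2) has_integral I) {0..x0}"
  shows "L2_norm_on (rect x0 y0) (\<lambda>p. f (fst p)) = sqrt (y0 * I)"
proof -
  have I': "((\<lambda>s. (f s)\<^sup>2) has_integral I) {0<..<x0}"
    using I by (simp add: has_integral_Icc_iff_Ioo)
  have "I \<ge> 0" by (rule has_integral_nonneg[OF I]) simp
  have [measurable]: "rect x0 y0 \<in> sets borel" by (simp add: open_rect)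
  have "(\<lambda>p. f (fst p)) \<in> borel_measurable (borel \<Otimes>\<^sub>M (borel :: real measure))"
    by measurable
  then have [measurable]: "(\<lambda>p. f (fst p)) \<in> borel_measurable (borel :: (real \<times> real) measure)"
    by (simp add: borel_prod)
  have "(\<integral>\<^sup>+ p. ennreal (indicator (rect x0 y0) p * (f (fst p))\<^sup>2) \<partial>lborel) =
      (\<integral>\<^sup>+ p. ennreal (indicator (rect x0 y0) p * (f (fst p))\<^sup>2) \<partial>(lborel \<Otimes>\<^sub>M lborel))"
    by (simp add: lborel_prod)
  also have "\<dots> = (\<integral>\<^sup>+ s. \<integral>\<^sup>+ y. ennreal (indicator (rect x0 y0) (s, y) * (f s)\<^sup>2) \<partial>lborel \<partial>lborel)"
    by (subst lborel.nn_integral_fst[symmetric]) (simp_all add: lborel_prod)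
  also have "\<dots> = (\<integral>\<^sup>+ s. ennreal y0 * (ennreal ((f s)\<^sup>2) * indicator {0<..<x0} s) \<partial>lborel)"
  proof (rule nn_integral_cong)
    fix s :: real
    have "(\<integral>\<^sup>+ y. ennreal (indicator (rect x0 y0) (s, y) * (f s)\<^sup>2) \<partial>lborel) =
        (\<integral>\<^sup>+ y. (ennreal ((f s)\<^sup>2) * indicator {0<..<x0} s) * indicator {0<..<y0} y \<partial>lborel)"
      by (intro nn_integral_cong) (auto simp: rect_def indicator_def)
    also have "\<dots> = ennreal y0 * (ennreal ((f s)\<^sup>2) * indicator {0<..<x0} s)"
      using pos by (subst nn_integral_cmult_indicator) (auto simp: mult.commute)
    finally show "(\<integral>\<^sup>+ y. ennreal (indicator (rect x0 y0) (s, y) * (f s)\<^sup>2) \<partial>lborel) =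
        ennreal y0 * (ennreal ((f s)\<^sup>2) * indicator {0<..<x0} s)" .
  qed
  also have "\<dots> = ennreal y0 * (\<integral>\<^sup>+ s. ennreal ((f s)\<^sup>2) * indicator {0<..<x0} s \<partial>lborel)"
    by (rule nn_integral_cmult) simp
  also have "(\<integral>\<^sup>+ s. ennreal ((f s)\<^sup>2) * indicator {0<..<x0} s \<partial>lborel) = ennreal I"
    using nn_integral_has_integral_lebesgue[OF _ I']
    by (simp add: ennreal_mult ennreal_indicator mult.commute)
  finally have nn: "(\<integral>\<^sup>+ p. ennreal (indicator (rect x0 y0) p * (f (fst p))\<^sup>2) \<partial>lborel) =
      ennreal (y0 * I)"
    using pos \<open>I \<ge> 0\<close> by (simp add: ennreal_mult)
  have "(LINT p:rect x0 y0|lebesgue. (f (fst p))\<^sup>2) =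
      integral\<^sup>L lborel (\<lambda>p. indicator (rect x0 y0) p * (f (fst p))\<^sup>2)"
    unfolding set_lebesgue_integral_def by (subst integral_completion) simp_all
  also have "\<dots> = y0 * I"
    by (subst integral_eq_nn_integral) (use nn pos \<open>I \<ge> 0\<close> in auto)
  finally show ?thesis by (simp add: L2_norm_on_def)
qed

section \<open>Minimizers of the quadratic cost\<close>

text \<open>Expanding the square under the integral shows that the cost is a quadratic in the control whose
  linear coefficient depends on the state only through its integral.\<close>

lemma cost_shift:
  assumes "x0 > 0" "y0 > 0" "\<phi> \<in> borel_measurable lebesgue"
    and bound: "\<And>p. p \<in> rect x0 y0 \<Longrightarrow> \<bar>\<phi> p\<bar> \<le> K"
  shows "cost x0 y0 z M (\<lambda>b p. \<phi> p + b) (b + s) =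
    cost x0 y0 z M (\<lambda>b p. \<phi> p + b) b
    + s * ((LINT p:rect x0 y0|lebesgue. \<phi> p) + x0 * y0 * (b - z) + M * y0 * b)
    + s\<^sup>2 / 2 * (y0 * (x0 + M))"
proof -
  define S where "S = rect x0 y0"
  have S: "S \<in> lmeasurable" "measure lebesgue S = x0 * y0"
    using measure_rect assms by (auto simp: S_def)
  note assms(3)[measurable]
  have c: "set_integrable lebesgue S (\<lambda>_. c :: real)" "(LINT p:S|lebesgue. c) = x0 * y0 * c"
    for c :: real
  proof -
    show c: "set_integrable lebesgue S (\<lambda>_. c :: real)"
      by (rule set_integrable_bounded[OF S(1), where K = "\<bar>c\<bar>"]) simp_all
    have "integrable lebesgue (indicat_real S)"
      using fmeasurableD[OF S(1)] fmeasurableD2[OF S(1)]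
      by (intro integrable_real_indicator) (simp_all add: less_top)
    then show "(LINT p:S|lebesgue. c) = x0 * y0 * c"
      unfolding set_lebesgue_integral_def using S(2) by simp
  qed
  have \<phi>: "set_integrable lebesgue S \<phi>"
    using bound by (intro set_integrable_bounded[OF S(1), where K = K]) (auto simp: S_def)
  have sq: "set_integrable lebesgue S (\<lambda>p. (\<phi> p + b - z)\<^sup>2)"
  proof (rule set_integrable_bounded[OF S(1), where K = "(K + \<bar>b\<bar> + \<bar>z\<bar>)\<^sup>2"])
    show "\<bar>(\<phi> p + b - z)\<^sup>2\<bar> \<le> (K + \<bar>b\<bar> + \<bar>z\<bar>)\<^sup>2" if "p \<in> S" for p
      using bound[of p] that power_mono[of "\<bar>\<phi> p + b - z\<bar>" "K + \<bar>b\<bar> + \<bar>z\<bar>" 2]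
      by (auto simp: S_def)
  qed measurable
  have "(LINT p:S|lebesgue. (\<phi> p + (b + s) - z)\<^sup>2) =
      (LINT p:S|lebesgue. (\<phi> p + b - z)\<^sup>2 + (2 * s * \<phi> p + (2 * s * (b - z) + s\<^sup>2)))"
    by (simp add: power2_eq_square algebra_simps)
  also have "\<dots> = (LINT p:S|lebesgue. (\<phi> p + b - z)\<^sup>2) +
      (2 * s * (LINT p:S|lebesgue. \<phi> p) + x0 * y0 * (2 * s * (b - z) + s\<^sup>2))"
    using c \<phi> sq by simp
  finally show ?thesis
    unfolding cost_def L2_norm_on_power2 S_def[symmetric]
    by (simp add: power2_eq_square field_simps)
qed

text \<open>The bracket multiplying \<open>s\<close> in the expansion of the cost must vanish at a minimizer, and this is
  a linear equation for \<open>b\<close>.  Stating the solution through the integral of the state \<open>\<phi>\<close> makes it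
  apply to the exact and to the discrete problem alike.\<close>

lemma minimizer_of_cost:
  assumes pos: "x0 > 0" "y0 > 0" "M > 0" and \<phi>: "\<phi> \<in> borel_measurable lebesgue"
    and bound: "\<And>p. p \<in> rect x0 y0 \<Longrightarrow> \<bar>\<phi> p\<bar> \<le> K"
    and min: "is_arg_min (cost x0 y0 z M (\<lambda>b p. \<phi> p + b)) (\<lambda>_. True) b"
  shows "b = (x0 * y0 * z - (LINT p:rect x0 y0|lebesgue. \<phi> p)) / (y0 * (x0 + M))"
proof -
  define L where "L = (LINT p:rect x0 y0|lebesgue. \<phi> p) + x0 * y0 * (b - z) + M * y0 * b"
  define A where "A = y0 * (x0 + M)"
  have "A > 0" using pos by (simp add: A_def)
  have "0 \<le> s * L + s\<^sup>2 / 2 * A" for s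
  proof -
    have "cost x0 y0 z M (\<lambda>b p. \<phi> p + b) b \<le> cost x0 y0 z M (\<lambda>b p. \<phi> p + b) (b + s)"
      using min by (simp add: is_arg_min_def not_less)
    then show ?thesis
      using cost_shift[OF pos(1,2) \<phi> bound, of z M b s] by (simp add: L_def A_def)
  qed
  from this[of "- L / A"] have "L\<^sup>2 \<le> 0"
    using \<open>A > 0\<close> by (simp add: power2_eq_square field_simps)
  then have "L = 0" by simp
  then show ?thesis using \<open>A > 0\<close> by (simp add: L_def A_def field_simps)
qed

section \<open>The discretisation error at a fixed control\<close>

text \<open>On each cell the discrete state is affine and the exact one is a parabola with the same second
  difference at the nodes; \<open>t\<close> is the distance of the point from the left node of its cell.  The
  error at a node grows linearly in \<open>x\<close> and has order \<open>h\<close>, whereas the part inside the cell has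
  order \<open>h\<^sup>2\<close>.\<close>

lemma disc_minus_exact:
  assumes "x0 > 0" "n \<ge> 1" and h: "h = x0 / real n"
  shows "\<exists>t \<in> {0..h}. u_disc x0 g q n b p
      - (- (1/2) * g * (fst p)\<^sup>2 + (g * x0 - q) * fst p + c)
    = (b - c) - g / 2 * h * fst p - g / 2 * t * (h - t)"
proof -
  have "h > 0" using assms by simp
  define k where "k = real_of_int \<lfloor>fst p / h\<rfloor>"
  define t where "t = fst p - k * h"
  have "k \<le> fst p / h" "fst p / h \<le> k + 1" unfolding k_def by linarith+
  then have "t \<in> {0..h}" using \<open>h > 0\<close> by (simp add: t_def field_simps)
  moreover have p: "fst p = k * h + t" by (simp add: t_def)
  have "u_disc x0 g q n b p =
      (g * x0 - q - h * g * (k + 1)) * fst p + h\<^sup>2 * g * ((k + 1) * k / 2) + b"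
    by (simp add: u_disc_def Let_def k_def flip: h)
  then have "u_disc x0 g q n b p - (- (1/2) * g * (fst p)\<^sup>2 + (g * x0 - q) * fst p + c)
    = (b - c) - g / 2 * h * fst p - g / 2 * t * (h - t)"
    by (simp add: p field_simps power2_eq_square)
  ultimately show ?thesis by blast
qed

lemma u_disc_measurable: "u_disc x0 g q n b \<in> borel_measurable lebesgue"
proof -
  have [measurable]: "(\<lambda>p :: real \<times> real. fst p) \<in> borel_measurable borel"
    by (intro borel_measurable_continuous_onI continuous_intros)
  have "u_disc x0 g q n b \<in> borel_measurable borel"
    unfolding u_disc_def Let_def by measurable
  then show ?thesis by (intro measurable_completion) simp
qed

text \<open>The discrete derivative is constant on a cell and agrees with the exact one at the right end.\<close>

lemma partial_x_disc_minus_exact: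
  assumes "x0 > 0" "n \<ge> 1" and h: "h = x0 / real n"
    and s: "of_int k * h < s" "s < (of_int k + 1) * h"
  shows "partial_x (u_disc x0 g q n b) (s, y) - (- g * s + (g * x0 - q))
    = g * (s - (of_int k + 1) * h)"
proof -
  have "h > 0" using assms by simp
  have "((\<lambda>s. (g * x0 - q - h * g * (of_int k + 1)) * s
      + h\<^sup>2 * g * ((of_int k + 1) * of_int k / 2) + b) has_real_derivative
      g * x0 - q - h * g * (of_int k + 1)) (at s)"
    by (auto intro!: derivative_eq_intros)
  then have "((\<lambda>s. u_disc x0 g q n b (s, y)) has_real_derivative
      g * x0 - q - h * g * (of_int k + 1)) (at s)"
  proof (rule has_field_derivative_transform_within_open)
    show "open {of_int k * h<..<(of_int k + 1) * h}" "s \<in> {of_int k * h<..<(of_int k + 1) * h}"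
      using s by auto
    fix r assume "r \<in> {of_int k * h<..<(of_int k + 1) * h}"
    then have "\<lfloor>r / h\<rfloor> = k"
      using \<open>h > 0\<close> by (simp add: floor_eq_iff field_simps)
    then show "(g * x0 - q - h * g * (of_int k + 1)) * r
        + h\<^sup>2 * g * ((of_int k + 1) * of_int k / 2) + b = u_disc x0 g q n b (r, y)"
      by (simp add: u_disc_def Let_def flip: h)
  qed
  then have "partial_x (u_disc x0 g q n b) (s, y) = g * x0 - q - h * g * (of_int k + 1)"
    by (simp add: partial_x_def DERIV_imp_deriv)
  then show ?thesis by (simp add: algebra_simps)
qed

text \<open>Divided by \<open>h\<close>, the derivative error is for \<open>g \<noteq> 0\<close> an ever faster sawtooth without a
  pointwise limit, so its norm is computed exactly: each of the \<open>n\<close> cells contributes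
  \<open>g\<^sup>2 h\<^sup>3 / 3\<close> to the integral of the square.\<close>

lemma L2_norm_partial_x_disc_minus_exact:
  assumes pos: "x0 > 0" "y0 > 0" "n \<ge> 1" and h: "h = x0 / real n"
  shows "L2_norm_on (rect x0 y0)
      (\<lambda>p. partial_x (u_disc x0 g q n b) p - (- g * fst p + (g * x0 - q)))
    = \<bar>g\<bar> * sqrt (x0 * y0 / 3) * h"
proof -
  have "h > 0" using assms by simp
  define r where "r = (\<lambda>s. partial_x (u_disc x0 g q n b) (s, 0) - (- g * s + (g * x0 - q)))"
  note cell = partial_x_disc_minus_exact[OF pos(1,3) h]
  have int: "((\<lambda>s. (r s)\<^sup>2) has_integral real m * (g\<^sup>2 * h^3 / 3)) {0..real m * h}" for m
  proof (induction m)
    case 0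
    show ?case using has_integral_refl(2)[of "\<lambda>s. (r s)\<^sup>2" 0] by simp
  next
    case (Suc m)
    have "((\<lambda>s. (g * (s - (real m + 1) * h))\<^sup>2) has_integral
        (g\<^sup>2 * ((real m + 1) * h - (real m + 1) * h)^3 / 3
          - g\<^sup>2 * (real m * h - (real m + 1) * h)^3 / 3)) {real m * h..(real m + 1) * h}"
      using \<open>h > 0\<close>
      by (intro fundamental_theorem_of_calculus)
         (auto simp: has_real_derivative_iff_has_vector_derivative[symmetric]
               power_mult_distrib intro!: derivative_eq_intros)
    then have "((\<lambda>s. (g * (s - (real m + 1) * h))\<^sup>2) has_integral g\<^sup>2 * h^3 / 3)
        {real m * h..(real m + 1) * h}"
      by (simp add: algebra_simps power3_eq_cube)
    then have "((\<lambda>s. (r s)\<^sup>2) has_integral g\<^sup>2 * h^3 / 3) {real m * h..(real m + 1) * h}"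
      by (rule has_integral_spike_finite[of "{real m * h, (real m + 1) * h}", rotated 2])
         (auto simp: r_def cell[of "int m", simplified])
    then have "((\<lambda>s. (r s)\<^sup>2) has_integral real m * (g\<^sup>2 * h^3 / 3) + g\<^sup>2 * h^3 / 3)
        {0..(real m + 1) * h}"
      using Suc \<open>h > 0\<close> by (intro has_integral_combine[of 0 "real m * h"]) auto
    then show ?case by (simp add: algebra_simps add_divide_distrib)
  qed
  \<comment> \<open>The value of \<open>r\<close> at the nodes is an arbitrary value of \<open>deriv\<close>; they form a countable set.\<close>
  have "r \<in> borel_measurable borel"
  proof (rule measurable_discrete_difference)
    show "(\<lambda>s. g * (s - (real_of_int \<lfloor>s / h\<rfloor> + 1) * h)) \<in> borel_measurable borel" by measurable
    show "countable (range (\<lambda>k. real_of_int k * h))" by simp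
    fix s assume s: "s \<notin> range (\<lambda>k. real_of_int k * h)"
    define k where "k = \<lfloor>s / h\<rfloor>"
    have "real_of_int k \<le> s / h" "s / h < real_of_int k + 1" unfolding k_def by linarith+
    then have "real_of_int k * h \<le> s" "s < (real_of_int k + 1) * h"
      using \<open>h > 0\<close> by (simp_all add: field_simps)
    moreover have "s \<noteq> real_of_int k * h" using s by blast
    ultimately show "g * (s - (real_of_int \<lfloor>s / h\<rfloor> + 1) * h) = r s"
      using cell[where k = k and s = s and g = g and q = q and b = b and y = 0] by (simp add: r_def flip: k_def)
  qed auto
  moreover have "((\<lambda>s. (r s)\<^sup>2) has_integral g\<^sup>2 * x0 / 3 * h\<^sup>2) {0..x0}"
  proof -
    have nh: "real n * h = x0" using pos h by simp
    have eq: "real n * (g\<^sup>2 * h^3 / 3) = g\<^sup>2 * (real n * h) / 3 * h\<^sup>2"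
      by (simp add: power2_eq_square power3_eq_cube)
    show ?thesis using int[of n] unfolding eq nh .
  qed
  ultimately have "L2_norm_on (rect x0 y0) (\<lambda>p. r (fst p)) = sqrt (y0 * (g\<^sup>2 * x0 / 3 * h\<^sup>2))"
    by (rule L2_norm_on_rect_fst[OF pos(1,2)])
  also have "\<dots> = \<bar>g\<bar> * sqrt (x0 * y0 / 3) * h"
    using \<open>h > 0\<close> by (simp add: real_sqrt_mult real_sqrt_divide)
  also have "(\<lambda>p. r (fst p)) =
      (\<lambda>p. partial_x (u_disc x0 g q n b) p - (- g * fst p + (g * x0 - q)))"
    by (simp add: r_def partial_x_def u_disc_def)
  finally show ?thesis .
qed

section \<open>Convergence of the optimal states\<close>

theorem lemma17:
  fixes x0 y0 g q z\<^sub>d M\<^sub>3 b\<^sub>o\<^sub>p :: real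
    and u :: "real \<Rightarrow> real \<times> real \<Rightarrow> real"
    and bh\<^sub>o\<^sub>p :: "nat \<Rightarrow> real"
  assumes "x0 > 0" and "y0 > 0" and "M\<^sub>3 > 0"
    and "\<And>b. solves_S x0 y0 g q b (u b)"
    and "is_arg_min (cost x0 y0 z\<^sub>d M\<^sub>3 u) (\<lambda>_. True) b\<^sub>o\<^sub>p"
    and "\<And>n. n \<ge> 1 \<Longrightarrow>
      is_arg_min (cost x0 y0 z\<^sub>d M\<^sub>3 (u_disc x0 g q n)) (\<lambda>_. True) (bh\<^sub>o\<^sub>p n)"
  shows "\<exists>C\<^sub>1\<^sub>5 C\<^sub>1\<^sub>6 :: real.
      (\<lambda>n. L2_norm_on (rect x0 y0)
             (\<lambda>p. u_disc x0 g q n (bh\<^sub>o\<^sub>p n) p - u b\<^sub>o\<^sub>p p)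
           - C\<^sub>1\<^sub>5 * (x0 / real n)) \<in> o(\<lambda>n. x0 / real n) \<and>
      (\<lambda>n. L2_norm_on (rect x0 y0)
             (\<lambda>p. partial_x (u_disc x0 g q n (bh\<^sub>o\<^sub>p n)) p - partial_x (u b\<^sub>o\<^sub>p) p)
           - C\<^sub>1\<^sub>6 * (x0 / real n)) \<in> o(\<lambda>n. x0 / real n)"
proof -
  define R where "R = rect x0 y0"
  define h where "h = (\<lambda>n. x0 / real n)"
  define v where
    "v = (\<lambda>p :: real \<times> real. - (1/2) * g * (fst p)\<^sup>2 + (g * x0 - q) * fst p)"
  \<comment> \<open>The state and control errors divided by the mesh size.  At \<open>n = 0\<close> the mesh size is \<open>0\<close>, so
    both vanish there and the uniform bounds below hold for every \<open>n\<close>.\<close>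
  define d where "d = (\<lambda>n p. (u_disc x0 g q n 0 p - v p) / h n)"
  define \<beta> where "\<beta> = (\<lambda>n. (bh\<^sub>o\<^sub>p n - b\<^sub>o\<^sub>p) / h n)"
  note pos = assms(1-3)
  have R: "R \<in> lmeasurable" using measure_rect(1)[OF pos(1,2)] by (simp add: R_def)
  have fst_R: "0 < fst p" "fst p < x0" if "p \<in> R" for p
    using that by (auto simp: R_def rect_def)
  have h: "0 < h n" "h n \<le> x0" if "n \<ge> 1" for n
    using that pos by (auto simp: h_def field_simps)
  have h_lim: "h \<longlonglongrightarrow> 0" unfolding h_def by (rule lim_const_over_n)
  have h_ev: "eventually (\<lambda>n. h n \<noteq> 0) sequentially"
    using eventually_ge_at_top[of 1] by eventually_elim (use h in force)

  have u: "u b p = v p + b" if "p \<in> R" for b p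
    using solution_unique[OF pos(1,2) assms(4), of p b] that
    by (auto simp: R_def rect_def v_def)
  have disc: "u_disc x0 g q n b = (\<lambda>p. u_disc x0 g q n 0 p + b)" for n b
    by (auto simp: u_disc_def Let_def)

  have d_close: "\<bar>d n p + g / 2 * fst p\<bar> \<le> \<bar>g\<bar> / 2 * h n" if n: "n \<ge> 1" for n p
  proof -
    obtain t where t: "t \<in> {0..h n}"
      and eq: "u_disc x0 g q n 0 p - v p = - (g / 2 * h n * fst p) - g / 2 * t * (h n - t)"
      using disc_minus_exact[OF pos(1) n refl, of g q 0 p 0] unfolding v_def h_def by auto
    have "d n p + g / 2 * fst p = - (g / 2 * ((t / h n) * (h n - t)))"
      using h[OF n] unfolding d_def eq by (simp add: field_simps)
    also have "\<bar>\<dots>\<bar> = \<bar>g\<bar> / 2 * ((t / h n) * (h n - t))"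
      using t h[OF n] by (simp add: abs_mult)
    also have "\<dots> \<le> \<bar>g\<bar> / 2 * (1 * h n)"
      using t h[OF n] by (intro mult_left_mono mult_mono) auto
    finally show ?thesis by simp
  qed
  have d_bound: "\<bar>d n p\<bar> \<le> \<bar>g\<bar> * x0" if "p \<in> R" for n p
  proof (cases "n \<ge> 1")
    case True
    have "\<bar>g / 2 * fst p\<bar> \<le> \<bar>g\<bar> / 2 * x0" "\<bar>g\<bar> / 2 * h n \<le> \<bar>g\<bar> / 2 * x0"
      using fst_R[OF that] h[OF True] by (auto simp: abs_mult intro!: mult_left_mono)
    with d_close[OF True, of p] show ?thesis by linarith
  next
    case False
    then have "n = 0" by simp
    then show ?thesis using pos by (simp add: d_def h_def)
  qed
  have d_lim: "(\<lambda>n. d n p) \<longlonglongrightarrow> - (g / 2 * fst p)" for p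
  proof -
    have "\<forall>\<^sub>F n in sequentially. norm (d n p + g / 2 * fst p) \<le> \<bar>g\<bar> / 2 * h n"
      using eventually_ge_at_top[of 1] by eventually_elim (simp only: real_norm_def d_close)
    then have "(\<lambda>n. d n p + g / 2 * fst p) \<longlonglongrightarrow> 0"
      by (rule Lim_null_comparison) (rule tendsto_mult_right_zero[OF h_lim])
    from tendsto_diff[OF this tendsto_const[of "g / 2 * fst p"]] show ?thesis by simp
  qed
  have [measurable]: "(\<lambda>p :: real \<times> real. fst p) \<in> borel_measurable lebesgue"
    by (intro measurable_completion) (simp add: borel_measurable_continuous_onI continuous_on_fst)
  note u_disc_measurable[measurable]
  have v_meas [measurable]: "v \<in> borel_measurable lebesgue" unfolding v_def by measurable
  have d_meas [measurable]: "d n \<in> borel_measurable lebesgue" for n unfolding d_def by measurable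
  have g_meas: "(\<lambda>p :: real \<times> real. - (g / 2 * fst p)) \<in> borel_measurable lebesgue" by measurable
  have v_bound: "\<bar>v p\<bar> \<le> \<bar>g\<bar> / 2 * x0\<^sup>2 + \<bar>g * x0 - q\<bar> * x0" if "p \<in> R" for p
  proof -
    have "\<bar>v p\<bar> \<le> \<bar>- (1/2) * g * (fst p)\<^sup>2\<bar> + \<bar>(g * x0 - q) * fst p\<bar>"
      unfolding v_def by (rule abs_triangle_ineq)
    also have "\<dots> = \<bar>g\<bar> / 2 * (fst p)\<^sup>2 + \<bar>g * x0 - q\<bar> * fst p"
      using fst_R[OF that] by (simp add: abs_mult)
    also have "\<dots> \<le> \<bar>g\<bar> / 2 * x0\<^sup>2 + \<bar>g * x0 - q\<bar> * x0"
      using fst_R[OF that] by (intro add_mono mult_mono power_mono) auto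
    finally show ?thesis .
  qed
  have disc_eq: "u_disc x0 g q n 0 p = v p + h n * d n p" if "n \<ge> 1" for n p
    using h[OF that] by (simp add: d_def)

  have b: "b\<^sub>o\<^sub>p = (x0 * y0 * z\<^sub>d - (LINT p:R|lebesgue. v p)) / (y0 * (x0 + M\<^sub>3))"
    unfolding R_def
  proof (rule minimizer_of_cost[OF pos v_meas])
    have "L2_norm_on R (\<lambda>p. u b p - z\<^sub>d) = L2_norm_on R (\<lambda>p. v p + b - z\<^sub>d)" for b
      by (rule L2_norm_on_cong) (simp add: u)
    then have "cost x0 y0 z\<^sub>d M\<^sub>3 u = cost x0 y0 z\<^sub>d M\<^sub>3 (\<lambda>b p. v p + b)"
      by (intro ext) (simp add: cost_def R_def)
    with assms(5) show "is_arg_min (cost x0 y0 z\<^sub>d M\<^sub>3 (\<lambda>b p. v p + b)) (\<lambda>_. True) b\<^sub>o\<^sub>p"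
      by simp
  qed (use v_bound in \<open>simp add: R_def\<close>)
  have bh: "bh\<^sub>o\<^sub>p n =
      (x0 * y0 * z\<^sub>d - (LINT p:R|lebesgue. u_disc x0 g q n 0 p)) / (y0 * (x0 + M\<^sub>3))"
    if n: "n \<ge> 1" for n
    unfolding R_def
  proof (rule minimizer_of_cost[OF pos u_disc_measurable])
    show "\<bar>u_disc x0 g q n 0 p\<bar> \<le> \<bar>g\<bar> / 2 * x0\<^sup>2 + \<bar>g * x0 - q\<bar> * x0 + h n * (\<bar>g\<bar> * x0)"
      if "p \<in> rect x0 y0" for p
    proof -
      have "\<bar>h n * d n p\<bar> \<le> h n * (\<bar>g\<bar> * x0)"
        using d_bound[of p n] that h[OF n] by (simp add: abs_mult R_def)
      then show ?thesis using v_bound[of p] that unfolding disc_eq[OF n] R_def by linarith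
    qed
    show "is_arg_min (cost x0 y0 z\<^sub>d M\<^sub>3 (\<lambda>b p. u_disc x0 g q n 0 p + b)) (\<lambda>_. True) (bh\<^sub>o\<^sub>p n)"
      using assms(6)[OF n] unfolding disc[symmetric] by simp
  qed
  have \<beta>: "\<beta> n = - (LINT p:R|lebesgue. d n p) / (y0 * (x0 + M\<^sub>3))" if n: "n \<ge> 1" for n
  proof -
    have "set_integrable lebesgue R v" "set_integrable lebesgue R (d n)"
      using v_bound d_bound by (blast intro: set_integrable_bounded[OF R] v_meas d_meas)+
    then have "(LINT p:R|lebesgue. u_disc x0 g q n 0 p)
        = (LINT p:R|lebesgue. v p) + h n * (LINT p:R|lebesgue. d n p)"
      by (simp add: disc_eq[OF n])
    then have "bh\<^sub>o\<^sub>p n - b\<^sub>o\<^sub>p = h n * (- (LINT p:R|lebesgue. d n p) / (y0 * (x0 + M\<^sub>3)))"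
      unfolding b bh[OF n] diff_divide_distrib[symmetric] by simp
    then show ?thesis using h[OF n] by (simp add: \<beta>_def)
  qed
  \<comment> \<open>The limit of the scaled control errors: the preceding formula with \<open>d n\<close> replaced by its
    pointwise limit.\<close>
  define \<kappa> where "\<kappa> = - (LINT p:R|lebesgue. - (g / 2 * fst p)) / (y0 * (x0 + M\<^sub>3))"
  have "(\<lambda>n. - (LINT p:R|lebesgue. d n p) / (y0 * (x0 + M\<^sub>3))) \<longlonglongrightarrow> \<kappa>"
    unfolding \<kappa>_def using pos d_bound
    by (intro tendsto_intros set_integral_bounded_convergence[OF R d_meas g_meas _ d_lim]) auto
  then have \<beta>_lim: "\<beta> \<longlonglongrightarrow> \<kappa>"
    by (rule Lim_transform_eventually)
       (use eventually_ge_at_top[of 1] in \<open>eventually_elim, simp only: \<beta>\<close>)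
  then obtain K where K: "\<And>n. \<bar>\<beta> n\<bar> \<le> K"
    by (metis BseqE convergentI convergent_imp_Bseq real_norm_def)

  define C15 where "C15 = L2_norm_on R (\<lambda>p. - (g / 2 * fst p) + \<kappa>)"
  define C16 where "C16 = \<bar>g\<bar> * sqrt (x0 * y0 / 3)"
  have "(\<lambda>n. L2_norm_on R (\<lambda>p. d n p + \<beta> n)) \<longlonglongrightarrow> C15"
    unfolding C15_def
  proof (rule L2_norm_on_bounded_convergence[OF R])
    show "\<bar>d n p + \<beta> n\<bar> \<le> \<bar>g\<bar> * x0 + K" if "p \<in> R" for n p
      using d_bound[OF that, of n] K[of n] by linarith
    show "(\<lambda>n. d n p + \<beta> n) \<longlonglongrightarrow> - (g / 2 * fst p) + \<kappa>" for p
      by (intro tendsto_add d_lim \<beta>_lim)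
  qed measurable
  \<comment> \<open>The scaled total error is the sum of the scaled state error at control \<open>0\<close> and of the scaled
    control error, since the control enters both states additively.\<close>
  moreover have "L2_norm_on R (\<lambda>p. d n p + \<beta> n) =
      L2_norm_on R (\<lambda>p. u_disc x0 g q n (bh\<^sub>o\<^sub>p n) p - u b\<^sub>o\<^sub>p p) / h n" for n
  proof -
    have "L2_norm_on R (\<lambda>p. d n p + \<beta> n) =
        L2_norm_on R (\<lambda>p. 1 / h n * (u_disc x0 g q n (bh\<^sub>o\<^sub>p n) p - u b\<^sub>o\<^sub>p p))"
      by (rule L2_norm_on_cong)
         (simp add: u disc[of n "bh\<^sub>o\<^sub>p n"] d_def \<beta>_def diff_divide_distrib add_divide_distrib)
    also have "\<dots> = L2_norm_on R (\<lambda>p. u_disc x0 g q n (bh\<^sub>o\<^sub>p n) p - u b\<^sub>o\<^sub>p p) / h n"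
      unfolding L2_norm_on_scale using pos by (simp add: h_def)
    finally show ?thesis .
  qed
  ultimately have lim:
    "(\<lambda>n. L2_norm_on R (\<lambda>p. u_disc x0 g q n (bh\<^sub>o\<^sub>p n) p - u b\<^sub>o\<^sub>p p) / h n) \<longlonglongrightarrow> C15"
    by simp
  have "(\<lambda>n. L2_norm_on R (\<lambda>p. u_disc x0 g q n (bh\<^sub>o\<^sub>p n) p - u b\<^sub>o\<^sub>p p) - C15 * h n) \<in> o(h)"
  proof (rule smalloI_tendsto[OF _ h_ev])
    from tendsto_diff[OF lim tendsto_const[of C15]]
    have "(\<lambda>n. L2_norm_on R (\<lambda>p. u_disc x0 g q n (bh\<^sub>o\<^sub>p n) p - u b\<^sub>o\<^sub>p p) / h n - C15)
      \<longlonglongrightarrow> 0" by simp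
    then show "(\<lambda>n. (L2_norm_on R (\<lambda>p. u_disc x0 g q n (bh\<^sub>o\<^sub>p n) p - u b\<^sub>o\<^sub>p p) - C15 * h n)
        / h n) \<longlonglongrightarrow> 0"
      by (rule Lim_transform_eventually)
         (use h_ev in \<open>eventually_elim, simp add: diff_divide_distrib\<close>)
  qed
  moreover have grad: "L2_norm_on R
      (\<lambda>p. partial_x (u_disc x0 g q n (bh\<^sub>o\<^sub>p n)) p - partial_x (u b\<^sub>o\<^sub>p) p) = C16 * h n"
    if n: "n \<ge> 1" for n
  proof -
    have "partial_x (u b\<^sub>o\<^sub>p) p = - g * fst p + (g * x0 - q)" if "p \<in> R" for p
    proof -
      have "((\<lambda>s. v (s, snd p) + b\<^sub>o\<^sub>p) has_real_derivative - g * fst p + (g * x0 - q)) (at (fst p))"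
        unfolding v_def by (auto intro!: derivative_eq_intros)
      then have "((\<lambda>s. u b\<^sub>o\<^sub>p (s, snd p)) has_real_derivative - g * fst p + (g * x0 - q))
          (at (fst p))"
        by (rule has_field_derivative_transform_within_open[where S = "{0<..<x0}"])
           (use that in \<open>auto simp: u R_def rect_def\<close>)
      then show ?thesis by (simp add: partial_x_def DERIV_imp_deriv)
    qed
    then have "L2_norm_on R
        (\<lambda>p. partial_x (u_disc x0 g q n (bh\<^sub>o\<^sub>p n)) p - partial_x (u b\<^sub>o\<^sub>p) p) =
      L2_norm_on R (\<lambda>p. partial_x (u_disc x0 g q n (bh\<^sub>o\<^sub>p n)) p - (- g * fst p + (g * x0 - q)))"
      by (intro L2_norm_on_cong) simp
    also have "\<dots> = C16 * h n"
      unfolding R_def C16_def h_def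
      by (rule L2_norm_partial_x_disc_minus_exact[OF pos(1,2) n refl])
    finally show ?thesis .
  qed
  have "(\<lambda>n. L2_norm_on R
      (\<lambda>p. partial_x (u_disc x0 g q n (bh\<^sub>o\<^sub>p n)) p - partial_x (u b\<^sub>o\<^sub>p) p) - C16 * h n) \<in> o(h)"
  proof (rule smalloI_tendsto[OF _ h_ev])
    show "(\<lambda>n. (L2_norm_on R (\<lambda>p. partial_x (u_disc x0 g q n (bh\<^sub>o\<^sub>p n)) p
        - partial_x (u b\<^sub>o\<^sub>p) p) - C16 * h n) / h n) \<longlonglongrightarrow> 0"
      by (rule tendsto_eventually)
         (use eventually_ge_at_top[of 1] in \<open>eventually_elim, simp only: grad diff_self div_0\<close>)
  qed
  ultimately show ?thesis
    unfolding R_def h_def by blast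
qed

end
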